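(* Let $T=(T^{*},T^{\triangle})$ be a spherical latin bitrade and let $a=(a_1,a_2,a_3)\in T^{*}$ be such that the solution of $\operatorname{Eq}(T,a)$ is separated. Then the triangles $\Delta(c,a)$, $c\in T^{\triangle}$, are all nondegenerate and they dissect the triangle $\Sigma=\{(x,y): x\ge 0,\ y\ge 0,\ x+y\le 1\}$, i.e. $\bigcup_{c\in T^{\triangle}}\Delta(c,a)=\Sigma$ and distinct triangles $\Delta(c,a)$, $\Delta(c',a)$ ($c\neq c'$) have no common interior point. Moreover this dissection is separated.
   Context: A latin bitrade is a pair $T=(T^{*},T^{\triangle})$ of finite sets of triples satisfying: (R1) $T^{*}\cap T^{\triangle}=\emptyset$; (R2) for every $p\in T^{*}$ and all $r\neq s$ in $\{1,2,3\}$ there is exactly one $q\in T^{\triangle}$ with $p_r=q_r$ and $p_s=q_s$; (R3) for every $q\in T^{\triangle}$ and all $r\neq s$ in $\{1,2,3\}$ there is exactly one $p\in T^{*}$ with $q_r=p_r$ and $q_s=p_s$. First, second and third coordinates are called rows, columns and symbols; these three sets of labels are assumed pairwise disjoint. $T$ is indecomposable if it is not the disjoint union of two nonempty latin bitrades. The size is $s=|T^{*}|$; $o_i$ is the number of distinct $i$-th coordinates of elements of $T^{*}$, and $m=o_1+o_2+o_3$. $T$ is spherical if it is indecomposable and $m=s+2$. For $a=(a_1,a_2,a_3)\in T^{*}$, $\operatorname{Eq}(T,a)$ is the linear system whose unknowns are the row, column and symbol labels, consisting of the equations $b_1+b_2=b_3$ for all $(b_1,b_2,b_3)\in T^{*}\setminus\{a\}$,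 with the substitutions $a_1=0$, $a_2=0$, $a_3=1$. For spherical $T$ this system has a unique solution in rational numbers; the value assigned to a label $x$ is denoted $\bar x$ (so $\bar a_1=\bar a_2=0$, $\bar a_3=1$). The solution is called separated if for all $b,d\in T^{*}$ and $i\in\{1,2,3\}$: $\bar b_i=\bar d_i$ iff $b_i=d_i$. For $c=(c_1,c_2,c_3)\in T^{\triangle}$ (its coordinates are labels occurring in $T^{*}$), $\Delta(c,a)$ is the closed triangle in $\mathbb{R}^2$ bounded by the lines $y=\bar c_1$, $x=\bar c_2$ and $x+y=\bar c_3$ (the convex hull of their pairwise intersection points); it degenerates if the three lines pass through a common point. A dissection of $\Sigma$ into triangles whose sides lie on horizontal, vertical and slope $-1$ lines is called separated if (i) no point is a vertex of six dissecting triangles, and (ii) for every line $p$ containing a side of a dissecting triangle, the union of all sides of dissecting triangles contained in $p$ is a single contiguous segment. *)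

theory Defs
  imports "HOL-Analysis.Analysis"
begin

type_synonym 'a triple = "'a \<times> 'a \<times> 'a"

fun coord :: "nat \<Rightarrow> 'a triple \<Rightarrow> 'a" where
  "coord i (x, y, z) = (if i = 1 then x else if i = 2 then y else z)"

definition labels :: "nat \<Rightarrow> 'a triple set \<Rightarrow> 'a set" where
  "labels i A = coord i ` A"

definition latin_bitrade :: "'a triple set \<Rightarrow> 'a triple set \<Rightarrow> bool" where
  "latin_bitrade Ts Td \<longleftrightarrow>
     finite Ts \<and> finite Td \<and>
     (\<forall>i\<in>{1,2,3}. \<forall>j\<in>{1,2,3}. i \<noteq> j \<longrightarrow> labels i (Ts \<union> Td) \<inter> labels j (Ts \<union> Td) = {}) \<and>
     Ts \<inter> Td = {} \<and>
     (\<forall>p\<in>Ts. \<forall>r\<in>{1,2,3}. \<forall>s\<in>{1,2,3}. r \<noteq> s \<longrightarrow>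
        (\<exists>!q. q \<in> Td \<and> coord r p = coord r q \<and> coord s p = coord s q)) \<and>
     (\<forall>q\<in>Td. \<forall>r\<in>{1,2,3}. \<forall>s\<in>{1,2,3}. r \<noteq> s \<longrightarrow>
        (\<exists>!p. p \<in> Ts \<and> coord r q = coord r p \<and> coord s q = coord s p))"

definition indecomposable :: "'a triple set \<Rightarrow> 'a triple set \<Rightarrow> bool" where
  "indecomposable Ts Td \<longleftrightarrow>
     \<not> (\<exists>Us Ud Vs Vd. latin_bitrade Us Ud \<and> latin_bitrade Vs Vd \<and>
           (Us, Ud) \<noteq> ({}, {}) \<and> (Vs, Vd) \<noteq> ({}, {}) \<and>
           Us \<inter> Vs = {} \<and> Ud \<inter> Vd = {} \<and> Ts = Us \<union> Vs \<and> Td = Ud \<union> Vd)"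

definition spherical :: "'a triple set \<Rightarrow> 'a triple set \<Rightarrow> bool" where
  "spherical Ts Td \<longleftrightarrow> latin_bitrade Ts Td \<and> indecomposable Ts Td \<and>
     card (labels 1 Ts) + card (labels 2 Ts) + card (labels 3 Ts) = card Ts + 2"

text \<open>A solution of the system is a valuation of the labels. Its values at elements of the
  type that are not labels of the bitrade are irrelevant and left unconstrained.\<close>

definition Eq_solution :: "'a triple set \<Rightarrow> 'a triple \<Rightarrow> ('a \<Rightarrow> rat) \<Rightarrow> bool" where
  "Eq_solution Ts a v \<longleftrightarrow>
     v (coord 1 a) = 0 \<and> v (coord 2 a) = 0 \<and> v (coord 3 a) = 1 \<and>
     (\<forall>b \<in> Ts - {a}. v (coord 1 b) + v (coord 2 b) = v (coord 3 b))"

definition separated_solution :: "'a triple set \<Rightarrow> ('a \<Rightarrow> rat) \<Rightarrow> bool" where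
  "separated_solution Ts v \<longleftrightarrow>
     (\<forall>b\<in>Ts. \<forall>d\<in>Ts. \<forall>i\<in>{1,2,3}. v (coord i b) = v (coord i d) \<longleftrightarrow> coord i b = coord i d)"

definition row_line :: "('a \<Rightarrow> rat) \<Rightarrow> 'a triple \<Rightarrow> (real \<times> real) set" where
  "row_line v c = {(x, y). y = of_rat (v (coord 1 c))}"

definition column_line :: "('a \<Rightarrow> rat) \<Rightarrow> 'a triple \<Rightarrow> (real \<times> real) set" where
  "column_line v c = {(x, y). x = of_rat (v (coord 2 c))}"

definition symbol_line :: "('a \<Rightarrow> rat) \<Rightarrow> 'a triple \<Rightarrow> (real \<times> real) set" where
  "symbol_line v c = {(x, y). x + y = of_rat (v (coord 3 c))}"

definition Delta :: "('a \<Rightarrow> rat) \<Rightarrow> 'a triple \<Rightarrow> (real \<times> real) set" where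
  "Delta v c = convex hull
     (row_line v c \<inter> column_line v c \<union> row_line v c \<inter> symbol_line v c \<union>
      column_line v c \<inter> symbol_line v c)"

definition degenerate :: "('a \<Rightarrow> rat) \<Rightarrow> 'a triple \<Rightarrow> bool" where
  "degenerate v c \<longleftrightarrow> row_line v c \<inter> column_line v c \<inter> symbol_line v c \<noteq> {}"

definition Sigma_triangle :: "(real \<times> real) set" where
  "Sigma_triangle = {(x, y). x \<ge> 0 \<and> y \<ge> 0 \<and> x + y \<le> 1}"

text \<open>Here \<open>D\<close> is a set of nondegenerate triangles, each given as a set of points: the vertices
  of a triangle are its extreme points and its sides are its one-dimensional faces.\<close>

definition separated_dissection :: "(real \<times> real) set set \<Rightarrow> bool" where
  "separated_dissection D \<longleftrightarrow>
     \<not> (\<exists>z F. F \<subseteq> D \<and> card F = 6 \<and> (\<forall>t\<in>F. z extreme_point_of t)) \<and>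
     (\<forall>p. affine p \<and> aff_dim p = 1 \<and> (\<exists>t\<in>D. \<exists>e. e edge_of t \<and> e \<subseteq> p) \<longrightarrow>
        (\<exists>u w. \<Union>{e. e \<subseteq> p \<and> (\<exists>t\<in>D. e edge_of t)} = closed_segment u w))"

end

theory Submission
  imports Defs
begin

text \<open>All triangles \<open>\<Delta>(c, a)\<close> are traversed counterclockwise by the same rule, whichever way they
  point, so for a generic point the indicator of \<open>\<Delta>(c, a)\<close> is a winding number. It is a sum of terms
  that each involve only two coordinates of \<open>c\<close>, and for each pair of coordinates \<open>T\<^sup>*\<close> and \<open>T\<^sup>\<triangle>\<close>
  project onto the same set of pairs. Hence the sum of the indicators over \<open>T\<^sup>\<triangle>\<close> equals the same sum
  over \<open>T\<^sup>*\<close>, where every element other than \<open>a\<close> contributes \<open>0\<close> (its lines are concurrent) and \<open>a\<close>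
  contributes the indicator of \<open>\<Sigma>\<close>.

  By separatedness a point is a vertex of at most one triangle for each of the three pairs of line
  directions, so of at most three triangles. On each line, the union of the sides is bounded by points
  given by elements of \<open>T\<^sup>*\<close>. An element other than \<open>a\<close> is such an end point on at most two of its three
  lines, which gives at most \<open>2(s - 1)\<close> ends. There are \<open>m - 3 = s - 1\<close> lines besides the sides
  of \<open>\<Sigma>\<close>, and each has at least two ends; so each has exactly two, and the sides of \<open>\<Sigma>\<close> have no
  further ends.\<close>

section \<open>Triangles and their sides\<close>

definition hull_triangle :: "real \<Rightarrow> real \<Rightarrow> real \<Rightarrow> (real \<times> real) set" where
  "hull_triangle r k t = convex hull {(k, r), (t - r, r), (k, t - k)}"

lemma Delta_eq_triangle:
  "Delta v c = hull_triangle (of_rat (v (coord 1 c))) (of_rat (v (coord 2 c))) (of_rat (v (coord 3 c)))"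
proof -
  have "row_line v c \<inter> column_line v c = {(of_rat (v (coord 2 c)), of_rat (v (coord 1 c)))}"
    by (auto simp: row_line_def column_line_def)
  moreover have "row_line v c \<inter> symbol_line v c =
      {(of_rat (v (coord 3 c)) - of_rat (v (coord 1 c)), of_rat (v (coord 1 c)))}"
    by (auto simp: row_line_def symbol_line_def)
  moreover have "column_line v c \<inter> symbol_line v c =
      {(of_rat (v (coord 2 c)), of_rat (v (coord 3 c)) - of_rat (v (coord 2 c)))}"
    by (auto simp: column_line_def symbol_line_def)
  ultimately show ?thesis
    unfolding Delta_def hull_triangle_def by (simp add: insert_commute)
qed

text \<open>With \<open>d = t - r - k\<close> the vertices are \<open>(k, r)\<close>,
  \<open>(k + d, r)\<close> and \<open>(k, r + d)\<close>: a standard triangle scaled by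
  \<open>d\<close>, and turned over if \<open>d\<close> is negative. The common factor in the
  inequalities treats both orientations at once.\<close>

lemma mem_triangle_iff:
  assumes "t \<noteq> r + k"
  shows "(x, y) \<in> hull_triangle r k t \<longleftrightarrow>
    0 \<le> (x - k) * (t - r - k) \<and> 0 \<le> (y - r) * (t - r - k) \<and> 0 \<le> (t - x - y) * (t - r - k)"
    (is "_ \<longleftrightarrow> ?R")
proof -
  define d where "d = t - r - k"
  have d: "d \<noteq> 0" using assms by (simp add: d_def)
  have tri: "(x, y) \<in> hull_triangle r k t \<longleftrightarrow>
      (\<exists>u w. x = k + u * d \<and> y = r + w * d \<and> 0 \<le> u \<and> 0 \<le> w \<and> u + w \<le> 1)"
    unfolding hull_triangle_def convex_hull_3_alt by (auto simp: d_def algebra_simps)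
  also have "\<dots> \<longleftrightarrow> 0 \<le> (x - k) / d \<and> 0 \<le> (y - r) / d \<and> (x - k) / d + (y - r) / d \<le> 1"
  proof
    assume "\<exists>u w. x = k + u * d \<and> y = r + w * d \<and> 0 \<le> u \<and> 0 \<le> w \<and> u + w \<le> 1"
    then show "0 \<le> (x - k) / d \<and> 0 \<le> (y - r) / d \<and> (x - k) / d + (y - r) / d \<le> 1"
      using d by auto
  next
    assume "0 \<le> (x - k) / d \<and> 0 \<le> (y - r) / d \<and> (x - k) / d + (y - r) / d \<le> 1"
    then show "\<exists>u w. x = k + u * d \<and> y = r + w * d \<and> 0 \<le> u \<and> 0 \<le> w \<and> u + w \<le> 1"
      using d by (intro exI[of _ "(x - k) / d"] exI[of _ "(y - r) / d"]) simp
  qed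
  also have "(x - k) / d + (y - r) / d \<le> 1 \<longleftrightarrow> 0 \<le> (t - x - y) / d"
  proof -
    have "(t - x - y) / d = 1 - ((x - k) / d + (y - r) / d)"
      using d by (simp add: field_simps) (simp add: d_def algebra_simps)
    then show ?thesis by linarith
  qed
  finally show ?thesis
    unfolding d_def[symmetric] by (simp add: zero_le_divide_iff zero_le_mult_iff)
qed

lemma Sigma_triangle_eq: "Sigma_triangle = hull_triangle 0 0 1"
  by (auto simp: Sigma_triangle_def mem_triangle_iff)

lemma compact_triangle: "compact (hull_triangle r k t)"
  by (simp add: hull_triangle_def compact_convex_hull finite_imp_compact)

lemma interior_triangle_nonempty:
  assumes "t \<noteq> r + k"
  shows "interior (hull_triangle r k t) \<noteq> {}"
proof -
  define d where "d = t - r - k"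
  have d: "d \<noteq> 0" using assms by (simp add: d_def)
  define O' where "O' = {z :: real \<times> real. 0 < (fst z - k) * d \<and> 0 < (snd z - r) * d \<and>
    0 < (t - fst z - snd z) * d}"
  have "open O'"
    unfolding O'_def by (intro open_Collect_conj open_Collect_less continuous_intros)
  moreover have "O' \<subseteq> hull_triangle r k t"
    using assms by (auto simp: O'_def mem_triangle_iff d_def)
  \<comment> \<open>The centroid is a strictly interior point for either sign of
    \<open>d\<close>.\<close>
  moreover have "(k + d / 3, r + d / 3) \<in> O'"
  proof -
    have "t - (k + d / 3) - (r + d / 3) = d / 3" by (simp add: d_def field_simps)
    moreover have "d * d > 0" using d by (metis not_real_square_gt_zero)
    ultimately show ?thesis unfolding O'_def by (simp only: mem_Collect_eq fst_conv snd_conv) simp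
  qed
  ultimately show ?thesis using interior_maximal by blast
qed

text \<open>The winding number of the boundary of a triangle around \<open>(x, y)\<close>, counted along the
  horizontal ray to the right. Expanding the product gives summands each of which depends on only
  two of \<open>r\<close>, \<open>k\<close>, \<open>t\<close>.\<close>

definition winding :: "real \<Rightarrow> real \<Rightarrow> real \<Rightarrow> real \<Rightarrow> real \<Rightarrow> int" where
  "winding x y r k t =
     (of_bool (x + y < t) - of_bool (x < k)) * (of_bool (y < t - k) - of_bool (y < r))"

text \<open>The second factor is nonzero only if \<open>y\<close> lies between \<open>r\<close> and
  \<open>t - k\<close>; then the first is nonzero only if \<open>x\<close> lies between
  \<open>k\<close> and \<open>t - y\<close>. Both factors carry the sign of the orientation, so
  their product is 1 inside either kind of triangle.\<close>

lemma winding_eq_indicator: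
  assumes "t \<noteq> r + k" "y \<noteq> r" "x \<noteq> k" "x + y \<noteq> t"
  shows "winding x y r k t = of_bool ((x, y) \<in> hull_triangle r k t)"
proof (cases "t > r + k")
  case True
  then show ?thesis
    using assms by (auto simp: winding_def mem_triangle_iff zero_le_mult_iff of_bool_def)
next
  case False
  then have "t < r + k" using assms by simp
  then show ?thesis
    using assms by (auto simp: winding_def mem_triangle_iff zero_le_mult_iff of_bool_def)
qed

lemma winding_concurrent: "winding x y r k (r + k) = 0"
  by (simp add: winding_def)

text \<open>The line of the \<open>i\<close>-th kind with value \<open>w\<close>, parametrised by the abscissa for rows and by the
  ordinate for columns and symbols.\<close>

definition on_line :: "nat \<Rightarrow> real \<Rightarrow> real \<Rightarrow> real \<times> real" where
  "on_line i w s = (if i = 1 then (s, w) else if i = 2 then (w, s) else (w - s, s))"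

lemma on_line_segment:
  "on_line i w ` closed_segment a b = closed_segment (on_line i w a) (on_line i w b)"
proof -
  have "on_line i w ((1 - u) * a + u * b) =
      (1 - u) *\<^sub>R on_line i w a + u *\<^sub>R on_line i w b" for u
    by (simp add: on_line_def algebra_simps)
  then show ?thesis
    unfolding closed_segment_def by (auto simp: image_iff) (metis)+
qed

lemma range_on_line: "a \<noteq> b \<Longrightarrow> range (on_line i w) = affine hull {on_line i w a, on_line i w b}"
proof -
  assume ab: "a \<noteq> b"
  have shift: "on_line i w a + u *\<^sub>R (on_line i w b - on_line i w a) =
      on_line i w (a + u * (b - a))" for u
    by (simp add: on_line_def algebra_simps)
  have "s = a + (s - a) / (b - a) * (b - a)" for s
    using ab by simp
  then have "surj (\<lambda>u. a + u * (b - a))" by (rule surjI[OF sym])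
  then have "range (on_line i w) = range (\<lambda>u. on_line i w (a + u * (b - a)))"
    by (metis image_image)
  then show ?thesis unfolding affine_hull_2_alt shift .
qed

lemma range_on_line_inject:
  assumes "range (on_line i w) = range (on_line j w')" "i \<in> {1, 2, 3}" "j \<in> {1, 2, 3}"
  shows "i = j \<and> w = w'"
proof -
  have "on_line i w s \<in> range (on_line j w')" for s
    using assms(1) by blast
  from this[of 0] this[of 1] show ?thesis
    using assms(2,3) by (auto simp: on_line_def)
qed

text \<open>The sides run counterclockwise for both orientations: \<open>(k, r)\<close> to
  \<open>(t - r, r)\<close> to \<open>(k, t - k)\<close> and back, expressed in the parameter of
  \<open>on_line\<close>.\<close>

definition seg_start :: "nat \<Rightarrow> real \<Rightarrow> real \<Rightarrow> real \<Rightarrow> real" where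
  "seg_start i r k t = (if i = 1 then k else if i = 2 then t - k else r)"

definition seg_end :: "nat \<Rightarrow> real \<Rightarrow> real \<Rightarrow> real \<Rightarrow> real" where
  "seg_end i r k t = (if i = 1 then t - r else if i = 2 then r else t - k)"

lemma subset_3_card_2_iff:
  assumes "A \<noteq> B" "A \<noteq> C" "B \<noteq> C"
  shows "c \<subseteq> {A, B, C} \<and> card c = 2 \<longleftrightarrow> c \<in> {{A, B}, {C, A}, {B, C}}"
proof
  assume "c \<subseteq> {A, B, C} \<and> card c = 2"
  then obtain x y where "c = {x, y}" "x \<noteq> y" "x \<in> {A, B, C}" "y \<in> {A, B, C}"
    by (auto simp: card_2_iff)
  then show "c \<in> {{A, B}, {C, A}, {B, C}}" by (auto simp: insert_commute)
qed (use assms in auto)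

text \<open>The vertices are affinely independent, so the faces are the hulls of sets of vertices,
  and a face has dimension 1 iff it is spanned by two of them.\<close>

lemma edge_of_triangle_iff:
  assumes "t \<noteq> r + k"
  shows "e edge_of hull_triangle r k t \<longleftrightarrow>
    (\<exists>i\<in>{1, 2, 3}. e = on_line i (if i = 1 then r else if i = 2 then k else t) `
       closed_segment (seg_start i r k t) (seg_end i r k t))"
proof -
  let ?A = "(k, r)" and ?B = "(t - r, r)" and ?C = "(k, t - k)"
  have ne: "?A \<noteq> ?B" "?A \<noteq> ?C" "?B \<noteq> ?C" using assms by auto
  have indep: "\<not> affine_dependent {?A, ?B, ?C}"
  proof -
    have "\<not> collinear {?A, ?B, ?C}"
    proof
      assume "collinear {?A, ?B, ?C}"
      then have "collinear {?B, ?C, ?A}" by (simp add: insert_commute)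
      then obtain u where "?C = u *\<^sub>R ?B + (1 - u) *\<^sub>R ?A"
        using collinear_3_expand[of ?B ?C ?A] ne(1) by metis
      then have "t - k = u * r + (1 - u) * r" by simp
      then have "t - k = r" by (simp add: algebra_simps)
      then show False using assms by simp
    qed
    then show ?thesis using ne by (simp add: collinear_3_eq_affine_dependent)
  qed
  have "e edge_of hull_triangle r k t \<longleftrightarrow> (\<exists>c. c \<subseteq> {?A, ?B, ?C} \<and> e = convex hull c \<and> card c = 2)"
  proof -
    have "aff_dim (convex hull c) = 1 \<longleftrightarrow> card c = 2" if "c \<subseteq> {?A, ?B, ?C}" for c
      using affine_independent_subset[OF indep that] aff_dim_affine_independent[of c]
      by (simp add: aff_dim_convex_hull) linarith
    then show ?thesis
      unfolding edge_of_def hull_triangle_def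
      by (auto simp: face_of_convex_hull_affine_independent[OF indep])
  qed
  also have "\<dots> \<longleftrightarrow> e \<in> {convex hull {?A, ?B}, convex hull {?C, ?A}, convex hull {?B, ?C}}"
  proof -
    have "(\<exists>c. c \<subseteq> {?A, ?B, ?C} \<and> e = convex hull c \<and> card c = 2) \<longleftrightarrow>
        (\<exists>c. (c \<subseteq> {?A, ?B, ?C} \<and> card c = 2) \<and> e = convex hull c)"
      by (simp only: conj_ac)
    also have "\<dots> \<longleftrightarrow> (\<exists>c \<in> {{?A, ?B}, {?C, ?A}, {?B, ?C}}. e = convex hull c)"
      by (simp only: subset_3_card_2_iff[OF ne] Bex_def)
    finally show ?thesis by (simp only: bex_simps insert_iff empty_iff)
  qed
  also have "\<dots> \<longleftrightarrow> e \<in> {closed_segment ?A ?B, closed_segment ?C ?A, closed_segment ?B ?C}"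
    by (simp add: segment_convex_hull)
  finally show ?thesis
    by (simp add: on_line_segment) (simp add: on_line_def seg_start_def seg_end_def)
qed

section \<open>Compact subsets of the line\<close>

text \<open>Minimum and maximum of \<open>U\<close> serve; the nonempty interior lies strictly
  between them, so they differ.\<close>

lemma compact_real_frontier_bounds:
  fixes U :: "real set"
  assumes "compact U" "interior U \<noteq> {}"
  obtains m M where "m < M" "m \<in> frontier U" "M \<in> frontier U" "U \<subseteq> {m..M}"
proof -
  have "U \<noteq> {}" using assms(2) by auto
  obtain m where m: "m \<in> U" "\<And>x. x \<in> U \<Longrightarrow> m \<le> x"
    using compact_attains_inf[OF assms(1) \<open>U \<noteq> {}\<close>] by blast
  obtain M where M: "M \<in> U" "\<And>x. x \<in> U \<Longrightarrow> x \<le> M"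
    using compact_attains_sup[OF assms(1) \<open>U \<noteq> {}\<close>] by blast
  have sub: "U \<subseteq> {m..M}" using m M by auto
  have int: "interior U \<subseteq> {m<..<M}"
    using interior_mono[OF sub] by simp
  have "m < M" using int assms(2) by force
  moreover have "frontier U = U - interior U"
    using assms(1) by (simp add: frontier_def compact_imp_closed)
  moreover have "m \<notin> interior U" "M \<notin> interior U" using int by auto
  ultimately show ?thesis using that[of m M] m(1) M(1) sub by simp
qed

text \<open>Minimum and maximum exhaust the frontier. The open interval between them is connected
  and misses the frontier, so it lies in \<open>U\<close> or avoids \<open>U\<close>; the nonempty
  interior excludes the latter.\<close>

lemma compact_real_two_frontier_points:
  fixes U :: "real set"
  assumes "compact U" "interior U \<noteq> {}" "finite (frontier U)" "card (frontier U) \<le> 2"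
  shows "\<exists>u w. U = closed_segment u w"
proof -
  obtain m M where mM: "m < M" "m \<in> frontier U" "M \<in> frontier U" "U \<subseteq> {m..M}"
    using compact_real_frontier_bounds[OF assms(1,2)] .
  have fr: "frontier U = {m, M}"
    using card_seteq[OF assms(3), of "{m, M}"] mM assms(4) by auto
  have "{m, M} \<subseteq> U"
    using fr assms(1) by (metis compact_imp_closed frontier_subset_closed)
  have "{m<..<M} \<inter> frontier U = {}" using fr by auto
  then have "{m<..<M} \<inter> U = {} \<or> {m<..<M} \<subseteq> U"
    using connected_Int_frontier[of "{m<..<M}" U] by auto
  moreover have "{m<..<M} \<inter> U \<noteq> {}"
  proof
    assume "{m<..<M} \<inter> U = {}"
    then have "U \<subseteq> {m, M}" using mM(4) by force
    then have "interior U \<subseteq> interior {m, M}" by (rule interior_mono)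
    then show False using assms(2) by (simp add: empty_interior_finite)
  qed
  ultimately have "{m<..<M} \<subseteq> U" by blast
  then have "{m..M} \<subseteq> U"
    using \<open>{m, M} \<subseteq> U\<close> atLeastAtMost_diff_ends[of m M] by blast
  then have "U = {m..M}" using mM(4) by blast
  then show ?thesis using mM(1) closed_segment_eq_real_ivl[of m M] by auto
qed

text \<open>Equal signs of \<open>u\<close> and \<open>w\<close> put the two segments on opposite
  sides of \<open>s\<close>.\<close>

lemma interior_adjacent_segments:
  fixes s u w :: real
  assumes "0 < u * w"
  shows "s \<in> interior (closed_segment s (s + u) \<union> closed_segment (s - w) s)"
proof -
  define \<delta> where "\<delta> = min \<bar>u\<bar> \<bar>w\<bar>"
  have "{s - \<delta><..<s + \<delta>} \<subseteq> closed_segment s (s + u) \<union> closed_segment (s - w) s"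
    using assms by (auto simp: \<delta>_def closed_segment_eq_real_ivl zero_less_mult_iff)
  moreover have "s \<in> {s - \<delta><..<s + \<delta>}"
    using assms by (auto simp: \<delta>_def)
  ultimately show ?thesis by (meson interior_maximal open_greaterThanLessThan subsetD)
qed

section \<open>Covering by the triangles of a bitrade\<close>

locale bitrade_solution =
  fixes Ts Td :: "'a triple set" and a :: "'a triple" and v :: "'a \<Rightarrow> rat"
  assumes bitrade: "latin_bitrade Ts Td"
    and a_in: "a \<in> Ts"
    and solution: "Eq_solution Ts a v"
    and separated: "separated_solution Ts v"
begin

definition val :: "nat \<Rightarrow> 'a triple \<Rightarrow> real" where
  "val i c = of_rat (v (coord i c))"

section \<open>Partners in a bitrade and values of labels\<close>

lemma finite_Ts: "finite Ts" and finite_Td: "finite Td" and disjoint: "Ts \<inter> Td = {}"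
  using bitrade by (simp_all only: latin_bitrade_def)

lemma partner_Td:
  assumes "p \<in> Ts" "i \<in> {1, 2, 3}" "j \<in> {1, 2, 3}" "i \<noteq> j"
  shows "\<exists>!q. q \<in> Td \<and> coord i p = coord i q \<and> coord j p = coord j q"
proof -
  have "\<forall>p\<in>Ts. \<forall>r\<in>{1,2,3}. \<forall>s\<in>{1,2,3}. r \<noteq> s \<longrightarrow>
      (\<exists>!q. q \<in> Td \<and> coord r p = coord r q \<and> coord s p = coord s q)"
    using bitrade unfolding latin_bitrade_def by (elim conjE)
  from this[rule_format, OF assms] show ?thesis .
qed

lemma partner_Ts:
  assumes "q \<in> Td" "i \<in> {1, 2, 3}" "j \<in> {1, 2, 3}" "i \<noteq> j"
  shows "\<exists>!p. p \<in> Ts \<and> coord i q = coord i p \<and> coord j q = coord j p"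
proof -
  have "\<forall>q\<in>Td. \<forall>r\<in>{1,2,3}. \<forall>s\<in>{1,2,3}. r \<noteq> s \<longrightarrow>
      (\<exists>!p. p \<in> Ts \<and> coord r q = coord r p \<and> coord s q = coord s p)"
    using bitrade unfolding latin_bitrade_def by (elim conjE)
  from this[rule_format, OF assms] show ?thesis .
qed

lemma index:
  "(1::nat) \<in> {1, 2, 3}" "(2::nat) \<in> {1, 2, 3}" "(3::nat) \<in> {1, 2, 3}"
  "(1::nat) \<noteq> 2" "(2::nat) \<noteq> 3" "(1::nat) \<noteq> 3"
  by simp_all

lemma obtain_Td:
  assumes "p \<in> Ts" "i \<in> {1, 2, 3}" "j \<in> {1, 2, 3}" "i \<noteq> j"
  obtains q where "q \<in> Td" "coord i q = coord i p" "coord j q = coord j p"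
  using ex1_implies_ex[OF partner_Td[OF assms]] by (elim exE conjE) (simp only:)

lemma obtain_Ts:
  assumes "q \<in> Td" "i \<in> {1, 2, 3}" "j \<in> {1, 2, 3}" "i \<noteq> j"
  obtains p where "p \<in> Ts" "coord i p = coord i q" "coord j p = coord j q"
  using ex1_implies_ex[OF partner_Ts[OF assms]] by (elim exE conjE) (simp only:)

text \<open>Both elements are partners of the same \<open>p\<close> in \<open>Ts\<close> for the
  coordinates \<open>i\<close> and \<open>j\<close>, and that partner is unique.\<close>

lemma Td_eqI:
  assumes "c \<in> Td" "d \<in> Td" "i \<in> {1, 2, 3}" "j \<in> {1, 2, 3}" "i \<noteq> j"
    "coord i c = coord i d" "coord j c = coord j d"
  shows "c = d"
proof -
  obtain p where "p \<in> Ts" "coord i c = coord i p" "coord j c = coord j p"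
    using partner_Ts[OF assms(1,3,4,5)] by blast
  then show ?thesis
    using partner_Td[OF _ assms(3,4,5), of p] assms by metis
qed

lemma Ts_eqI:
  assumes "c \<in> Ts" "d \<in> Ts" "i \<in> {1, 2, 3}" "j \<in> {1, 2, 3}" "i \<noteq> j"
    "coord i c = coord i d" "coord j c = coord j d"
  shows "c = d"
proof -
  obtain p where "p \<in> Td" "coord i c = coord i p" "coord j c = coord j p"
    using partner_Td[OF assms(1,3,4,5)] by blast
  then show ?thesis
    using partner_Ts[OF _ assms(3,4,5), of p] assms by metis
qed

lemma sum_Td_eq_sum_Ts:
  assumes "i \<in> {1, 2, 3}" "j \<in> {1, 2, 3}" "i \<noteq> j"
  shows "(\<Sum>c\<in>Td. f (coord i c) (coord j c)) = (\<Sum>p\<in>Ts. f (coord i p) (coord j p))"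
proof -
  let ?h = "\<lambda>c :: 'a triple. (coord i c, coord j c)"
  have "inj_on ?h Td"
    by (rule inj_onI) (simp only: prod.inject Td_eqI[OF _ _ assms])
  moreover have "inj_on ?h Ts"
    by (rule inj_onI) (simp only: prod.inject Ts_eqI[OF _ _ assms])
  moreover have "?h ` Td = ?h ` Ts"
  proof (intro subset_antisym image_subsetI)
    fix c assume "c \<in> Td"
    then obtain p where "p \<in> Ts" "coord i p = coord i c" "coord j p = coord j c"
      using obtain_Ts assms by blast
    then show "?h c \<in> ?h ` Ts" by (intro image_eqI[of _ _ p]) simp_all
  next
    fix p assume "p \<in> Ts"
    then obtain c where "c \<in> Td" "coord i c = coord i p" "coord j c = coord j p"
      using obtain_Td assms by blast
    then show "?h p \<in> ?h ` Td" by (intro image_eqI[of _ _ c]) simp_all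
  qed
  ultimately show ?thesis
    using sum.reindex[of ?h Td "\<lambda>(x, y). f x y"] sum.reindex[of ?h Ts "\<lambda>(x, y). f x y"]
    by (simp add: o_def)
qed

lemma coord_Td_in_labels:
  assumes "c \<in> Td" "i \<in> {1, 2, 3}"
  shows "coord i c \<in> labels i Ts"
proof -
  obtain j where j: "j \<in> {1, 2, 3::nat}" "i \<noteq> j"
    by (metis insertCI numeral_eq_one_iff semiring_norm(85))
  obtain p where "p \<in> Ts" "coord i p = coord i c"
    using obtain_Ts[OF assms j] .
  then show ?thesis unfolding labels_def by (intro image_eqI[of _ _ p]) simp_all
qed

lemma label_in_Td:
  assumes "x \<in> labels i Ts" "i \<in> {1, 2, 3}"
  obtains c where "c \<in> Td" "coord i c = x"
proof -
  obtain j where j: "j \<in> {1, 2, 3::nat}" "i \<noteq> j"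
    by (metis insertCI numeral_eq_one_iff semiring_norm(85))
  obtain p where "p \<in> Ts" "x = coord i p" using assms(1) unfolding labels_def by blast
  then show ?thesis
    using obtain_Td[OF _ assms(2) j, of p] that by blast
qed

text \<open>Separatedness speaks of \<open>Ts\<close> alone; it extends to \<open>Td\<close> because
  every label of \<open>Td\<close> occurs in \<open>Ts\<close>.\<close>

lemma val_eq_iff:
  assumes "c \<in> Ts \<union> Td" "d \<in> Ts \<union> Td" "i \<in> {1, 2, 3}"
  shows "val i c = val i d \<longleftrightarrow> coord i c = coord i d"
proof -
  have "coord i c \<in> coord i ` Ts" "coord i d \<in> coord i ` Ts"
    using assms coord_Td_in_labels[OF _ assms(3)] unfolding labels_def by blast+
  then obtain b e where "b \<in> Ts" "coord i c = coord i b" "e \<in> Ts" "coord i d = coord i e"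
    by blast
  moreover from this(1,3) have "v (coord i b) = v (coord i e) \<longleftrightarrow> coord i b = coord i e"
    using separated assms(3) unfolding separated_solution_def by blast
  ultimately show ?thesis unfolding val_def by simp
qed

lemma val_a: "val 1 a = 0" "val 2 a = 0" "val 3 a = 1"
  using solution by (auto simp: Eq_solution_def val_def)

lemma val_concurrent: "p \<in> Ts \<Longrightarrow> p \<noteq> a \<Longrightarrow> val 3 p = val 1 p + val 2 p"
  using solution by (auto simp: Eq_solution_def val_def of_rat_add[symmetric])

text \<open>If the lines of \<open>c\<close> were concurrent, the equation of the partner
  \<open>p\<close> would give \<open>p\<close> the third value of \<open>c\<close> too, and
  separatedness would put \<open>c\<close> into \<open>Ts\<close>. Should \<open>p\<close> be
  \<open>a\<close>, which has no equation, the partner \<open>q\<close> for another pair of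
  coordinates takes over; it differs from \<open>a\<close>, as otherwise \<open>a\<close> would
  agree with \<open>c\<close> throughout.\<close>

lemma val_nondegenerate:
  assumes c: "c \<in> Td"
  shows "val 3 c \<noteq> val 1 c + val 2 c"
proof
  assume eq: "val 3 c = val 1 c + val 2 c"
  obtain p where p: "p \<in> Ts" "coord 1 p = coord 1 c" "coord 2 p = coord 2 c"
    using obtain_Ts[OF c index(1,2,4)] .
  obtain q where q: "q \<in> Ts" "coord 2 q = coord 2 c" "coord 3 q = coord 3 c"
    using obtain_Ts[OF c index(2,3,5)] .
  have ext: False
    if "b \<in> Ts" "coord 1 b = coord 1 c" "coord 2 b = coord 2 c" "coord 3 b = coord 3 c" for b
  proof -
    have "b = c" using that(2-4) by (cases b; cases c) simp
    then show False using that(1) c disjoint by blast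
  qed
  show False
  proof (cases "p = a")
    case False
    then have "val 3 p = val 3 c"
      using val_concurrent[OF p(1)] eq p by (simp add: val_def)
    then have "coord 3 p = coord 3 c"
      using val_eq_iff[OF _ _ index(3), of p c] p c by simp
    then show False using ext p by blast
  next
    case True
    have "q \<noteq> a" using True p q ext[of a] by auto
    then have "val 1 q = val 1 c"
      using val_concurrent[OF q(1)] eq q by (simp add: val_def)
    then have "coord 1 q = coord 1 c"
      using val_eq_iff[OF _ _ index(1), of q c] q c by simp
    then show False using ext q by blast
  qed
qed

lemma Delta_eq: "Delta v c = hull_triangle (val 1 c) (val 2 c) (val 3 c)"
  by (simp add: Delta_eq_triangle val_def)

section \<open>Covering numbers of generic points\<close>

lemma sum_winding:
  "(\<Sum>c\<in>Td. winding x y (val 1 c) (val 2 c) (val 3 c)) = winding x y 0 0 1"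
proof -
  \<comment> \<open>Expanding the product, \<open>B\<close> keeps both terms with the condition
    \<open>y < t - k\<close>, while \<open>A\<close> and \<open>C\<close> are the two terms with
    \<open>y < r\<close>.\<close>
  define A where "A r t = (of_bool (x + y < of_rat (v t)) * of_bool (y < of_rat (v r)) :: int)" for r t
  define B where "B k t = ((of_bool (x + y < of_rat (v t)) - of_bool (x < of_rat (v k)))
    * of_bool (y < of_rat (v t) - of_rat (v k)) :: int)" for k t
  define C where "C r k = (of_bool (x < of_rat (v k)) * of_bool (y < of_rat (v r)) :: int)" for r k
  have expand: "winding x y (val 1 c) (val 2 c) (val 3 c) =
      B (coord 2 c) (coord 3 c) - A (coord 1 c) (coord 3 c) + C (coord 1 c) (coord 2 c)" for c
    unfolding winding_def val_def A_def B_def C_def by (simp only: algebra_simps)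
  have "(\<Sum>c\<in>Td. winding x y (val 1 c) (val 2 c) (val 3 c)) =
      (\<Sum>p\<in>Ts. winding x y (val 1 p) (val 2 p) (val 3 p))"
    unfolding expand sum.distrib sum_subtractf
    using sum_Td_eq_sum_Ts[of 2 3 B] sum_Td_eq_sum_Ts[of 1 3 A] sum_Td_eq_sum_Ts[of 1 2 C] by simp
  also have "\<dots> = (\<Sum>p\<in>{a}. winding x y (val 1 p) (val 2 p) (val 3 p))"
    using finite_Ts a_in by (intro sum.mono_neutral_right) (auto simp: val_concurrent winding_concurrent)
  finally show ?thesis by (simp add: val_a del: One_nat_def)
qed

text \<open>Inserting \<open>a\<close> also excludes the lines through the sides of
  \<open>Sigma_triangle\<close>.\<close>

definition generic :: "(real \<times> real) set" where
  "generic = {(x, y). \<forall>c \<in> insert a Td. y \<noteq> val 1 c \<and> x \<noteq> val 2 c \<and> x + y \<noteq> val 3 c}"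

text \<open>The excluded points form finitely many lines, a negligible set, whereas a nonempty open
  set is not negligible.\<close>

lemma open_meets_generic:
  assumes "open S" "S \<noteq> {}"
  obtains x y where "(x, y) \<in> S" "(x, y) \<in> generic"
proof -
  have "- generic = (\<Union>c \<in> insert a Td.
      {z. (0, 1) \<bullet> z = val 1 c} \<union> {z. (1, 0) \<bullet> z = val 2 c} \<union> {z. (1, 1) \<bullet> z = val 3 c})"
    by (auto simp: generic_def inner_prod_def)
  moreover have "negligible \<dots>"
    using finite_Td
    by (intro negligible_Union ballI) (auto intro!: negligible_Un negligible_hyperplane simp: zero_prod_def)
  ultimately have "\<not> S \<subseteq> - generic"
    using open_not_negligible[OF assms] negligible_subset by metis
  then show ?thesis using that by force
qed

lemma card_covering:
  assumes "(x, y) \<in> generic"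
  shows "card {c \<in> Td. (x, y) \<in> Delta v c} = of_bool ((x, y) \<in> Sigma_triangle)"
proof -
  have "int (card {c \<in> Td. (x, y) \<in> Delta v c}) = (\<Sum>c\<in>Td. of_bool ((x, y) \<in> Delta v c))"
    using finite_Td by (simp add: of_bool_def sum.If_cases Int_def)
  also have "\<dots> = (\<Sum>c\<in>Td. winding x y (val 1 c) (val 2 c) (val 3 c))"
    using assms val_nondegenerate
    by (intro sum.cong refl) (auto simp: Delta_eq generic_def winding_eq_indicator)
  also have "\<dots> = of_bool ((x, y) \<in> Sigma_triangle)"
    using assms
    by (simp add: sum_winding Sigma_triangle_eq winding_eq_indicator generic_def val_a
        del: One_nat_def)
  finally show ?thesis by (simp add: of_bool_def split: if_splits)
qed

text \<open>A convex set with nonempty interior lies in the closure of that interior. This carries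
  facts about generic points over to all points.\<close>

lemma Delta_regular:
  assumes "c \<in> Td"
  shows "Delta v c \<subseteq> closure (interior (Delta v c))"
  using convex_closure_interior[of "Delta v c"] interior_triangle_nonempty[OF val_nondegenerate[OF assms]]
    closure_subset
  by (auto simp: Delta_eq hull_triangle_def)

text \<open>A point in one side but not in the other would, by regularity, yield a nonempty open set
  of such points. It contains a generic point, where \<open>card_covering\<close> gives a
  contradiction.\<close>

lemma Union_Delta: "(\<Union>c\<in>Td. Delta v c) = Sigma_triangle"
proof (intro subset_antisym UN_least)
  fix c assume c: "c \<in> Td"
  show "Delta v c \<subseteq> Sigma_triangle"
  proof (rule ccontr)
    assume "\<not> Delta v c \<subseteq> Sigma_triangle"
    then obtain z where "z \<in> closure (interior (Delta v c))" "z \<in> - Sigma_triangle"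
      using Delta_regular[OF c] by blast
    moreover have op: "open (- Sigma_triangle)"
      unfolding Sigma_triangle_eq by (intro open_Compl compact_imp_closed compact_triangle)
    ultimately have "- Sigma_triangle \<inter> interior (Delta v c) \<noteq> {}"
      by (metis disjoint_iff open_Int_closure_eq_empty)
    then obtain x y where xy: "(x, y) \<in> - Sigma_triangle \<inter> interior (Delta v c)" "(x, y) \<in> generic"
      by (metis open_Int open_interior op open_meets_generic)
    then have "c \<in> {c \<in> Td. (x, y) \<in> Delta v c}" "(x, y) \<notin> Sigma_triangle"
      using c interior_subset by auto
    then have "card {c \<in> Td. (x, y) \<in> Delta v c} \<noteq> 0"
      using finite_Td by (metis (no_types, lifting) card_0_eq empty_iff finite_subset mem_Collect_eq subsetI)
    then show False using card_covering[OF xy(2)] \<open>(x, y) \<notin> Sigma_triangle\<close> by simp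
  qed
next
  show "Sigma_triangle \<subseteq> (\<Union>c\<in>Td. Delta v c)"
  proof (rule ccontr)
    let ?U = "- (\<Union>c\<in>Td. Delta v c)"
    assume "\<not> Sigma_triangle \<subseteq> (\<Union>c\<in>Td. Delta v c)"
    moreover have "Sigma_triangle \<subseteq> closure (interior Sigma_triangle)"
      using convex_closure_interior[of Sigma_triangle] interior_triangle_nonempty[of 1 0 0] closure_subset
      by (auto simp: Sigma_triangle_eq hull_triangle_def)
    ultimately obtain z where "z \<in> closure (interior Sigma_triangle)" "z \<in> ?U"
      by blast
    moreover have op: "open ?U"
      unfolding Delta_eq
      by (intro open_Compl closed_UN finite_Td ballI compact_imp_closed compact_triangle)
    ultimately have "?U \<inter> interior Sigma_triangle \<noteq> {}"
      by (metis disjoint_iff open_Int_closure_eq_empty)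
    then obtain x y where xy: "(x, y) \<in> ?U \<inter> interior Sigma_triangle" "(x, y) \<in> generic"
      by (metis open_Int open_interior op open_meets_generic)
    then have "{c \<in> Td. (x, y) \<in> Delta v c} = {}" "(x, y) \<in> Sigma_triangle"
      using interior_subset by auto
    then show False using card_covering[OF xy(2)] by (simp only: card.empty) simp
  qed
qed

text \<open>A nonempty open overlap would contain a generic point covered twice.\<close>

lemma interior_Delta_disjoint:
  assumes "c \<in> Td" "d \<in> Td" "c \<noteq> d"
  shows "interior (Delta v c) \<inter> interior (Delta v d) = {}"
proof (rule ccontr)
  assume "interior (Delta v c) \<inter> interior (Delta v d) \<noteq> {}"
  then obtain x y where xy: "(x, y) \<in> interior (Delta v c) \<inter> interior (Delta v d)" "(x, y) \<in> generic"
    by (metis open_Int open_interior open_meets_generic)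
  then have "{c, d} \<subseteq> {c \<in> Td. (x, y) \<in> Delta v c}"
    using assms interior_subset by auto
  then have "card {c, d} \<le> card {c \<in> Td. (x, y) \<in> Delta v c}"
    using finite_Td by (intro card_mono) auto
  then show False
    using card_covering[OF xy(2)] assms(3) by (simp add: of_bool_def split: if_splits)
qed

section \<open>Triangles with a common vertex\<close>

lemma few_triangles_at_point:
  assumes F: "F \<subseteq> Delta v ` Td" and z: "\<And>t. t \<in> F \<Longrightarrow> z extreme_point_of t"
  shows "card F \<le> 3"
proof -
  obtain x y where z_eq: "z = (x, y)" by (cases z)
  \<comment> \<open>The triangles are sorted by the pair of their lines crossing at
    \<open>z\<close>. Such a pair fixes two labels, hence the element of \<open>Td\<close>.\<close>
  define X where "X = {c \<in> Td. val 1 c = y \<and> val 2 c = x}"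
  define Y where "Y = {c \<in> Td. val 1 c = y \<and> val 3 c = x + y}"
  define Z where "Z = {c \<in> Td. val 2 c = x \<and> val 3 c = x + y}"
  have fin: "finite X" "finite Y" "finite Z"
    using finite_Td by (auto simp: X_def Y_def Z_def)
  have single: "card A \<le> 1" if "\<And>c d. c \<in> A \<Longrightarrow> d \<in> A \<Longrightarrow> c = d" for A :: "'a triple set"
    using that by (metis card.infinite card_le_Suc0_iff_eq One_nat_def zero_le_one)
  have "card X \<le> 1"
  proof (rule single)
    fix c d assume cd: "c \<in> X" "d \<in> X"
    then have "coord 1 c = coord 1 d" "coord 2 c = coord 2 d"
      using val_eq_iff[OF _ _ index(1), of c d] val_eq_iff[OF _ _ index(2), of c d]
      by (simp_all add: X_def)
    then show "c = d" using Td_eqI[OF _ _ index(1,2,4), of c d] cd by (simp add: X_def)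
  qed
  moreover have "card Y \<le> 1"
  proof (rule single)
    fix c d assume cd: "c \<in> Y" "d \<in> Y"
    then have "coord 1 c = coord 1 d" "coord 3 c = coord 3 d"
      using val_eq_iff[OF _ _ index(1), of c d] val_eq_iff[OF _ _ index(3), of c d]
      by (simp_all add: Y_def)
    then show "c = d" using Td_eqI[OF _ _ index(1,3,6), of c d] cd by (simp add: Y_def)
  qed
  moreover have "card Z \<le> 1"
  proof (rule single)
    fix c d assume cd: "c \<in> Z" "d \<in> Z"
    then have "coord 2 c = coord 2 d" "coord 3 c = coord 3 d"
      using val_eq_iff[OF _ _ index(2), of c d] val_eq_iff[OF _ _ index(3), of c d]
      by (simp_all add: Z_def)
    then show "c = d" using Td_eqI[OF _ _ index(2,3,5), of c d] cd by (simp add: Z_def)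
  qed
  moreover have "F \<subseteq> Delta v ` (X \<union> Y \<union> Z)"
  proof
    fix t assume "t \<in> F"
    then obtain c where c: "c \<in> Td" "t = Delta v c" using F by blast
    have "z \<in> {(val 2 c, val 1 c), (val 3 c - val 1 c, val 1 c), (val 2 c, val 3 c - val 2 c)}"
      using z[OF \<open>t \<in> F\<close>] extreme_point_of_convex_hull unfolding c(2) Delta_eq hull_triangle_def by blast
    then have "c \<in> X \<union> Y \<union> Z" using c(1) by (auto simp: X_def Y_def Z_def z_eq)
    then show "t \<in> Delta v ` (X \<union> Y \<union> Z)" using c(2) by blast
  qed
  then have "card F \<le> card (X \<union> Y \<union> Z)"
    using fin by (meson card_image_le card_mono finite_UnI finite_imageI le_trans)
  moreover have "card (X \<union> Y \<union> Z) \<le> card X + card Y + card Z"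
    by (meson add_le_mono1 card_Un_le le_trans)
  ultimately show ?thesis by linarith
qed

subsection \<open>Sides on a common line\<close>

definition start :: "nat \<Rightarrow> 'a triple \<Rightarrow> real" where
  "start i c = seg_start i (val 1 c) (val 2 c) (val 3 c)"

definition finish :: "nat \<Rightarrow> 'a triple \<Rightarrow> real" where
  "finish i c = seg_end i (val 1 c) (val 2 c) (val 3 c)"

text \<open>The sign of the gap tells the two orientations of a triangle apart.\<close>

definition gap :: "'a triple \<Rightarrow> real" where
  "gap c = val 3 c - val 1 c - val 2 c"

text \<open>The union of the sides on a line, as a set of \<open>on_line\<close> parameters and
  indexed by the label of the line.\<close>

definition covered :: "nat \<Rightarrow> 'a \<Rightarrow> real set" where
  "covered i x = (\<Union>c \<in> {c \<in> Td. coord i c = x}. closed_segment (start i c) (finish i c))"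

definition nxt :: "nat \<Rightarrow> nat" where
  "nxt i = (if i = 1 then 2 else if i = 2 then 3 else 1)"

definition prv :: "nat \<Rightarrow> nat" where
  "prv i = (if i = 1 then 3 else if i = 2 then 1 else 2)"

lemma nxt_prv:
  assumes "i \<in> {1, 2, 3}"
  shows "nxt i \<in> {1, 2, 3}" "prv i \<in> {1, 2, 3}" "i \<noteq> nxt i" "i \<noteq> prv i" "nxt (prv i) = i"
  using assms by (auto simp: nxt_def prv_def)

text \<open>Side \<open>i\<close> starts where line \<open>i\<close> meets line \<open>nxt i\<close>
  and finishes where it meets line \<open>prv i\<close>.\<close>

lemma start_cong:
  assumes "i \<in> {1, 2, 3}" "coord i c = coord i d" "coord (nxt i) c = coord (nxt i) d"
  shows "start i c = start i d"
  using assms by (auto simp: start_def seg_start_def val_def nxt_def)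

lemma finish_cong:
  assumes "i \<in> {1, 2, 3}" "coord i c = coord i d" "coord (prv i) c = coord (prv i) d"
  shows "finish i c = finish i d"
  using assms by (auto simp: finish_def seg_end_def val_def prv_def)

text \<open>Counterclockwise, an upright triangle has its column side traversed downwards, hence the
  sign for \<open>i = 2\<close>.\<close>

lemma finish_eq_start: "finish i c = start i c + (if i = 2 then -1 else 1) * gap c"
  by (simp add: finish_def start_def seg_start_def seg_end_def gap_def)

lemma gap_Ts: "p \<in> Ts - {a} \<Longrightarrow> gap p = 0"
  using val_concurrent[of p] by (simp add: gap_def)

lemma gap_Td: "c \<in> Td \<Longrightarrow> gap c \<noteq> 0"
  using val_nondegenerate[of c] by (simp add: gap_def)

lemma start_neq_finish: "c \<in> Td \<Longrightarrow> start i c \<noteq> finish i c"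
  using gap_Td[of c] by (simp add: finish_eq_start)

lemma compact_covered: "compact (covered i x)"
  unfolding covered_def using finite_Td by (intro compact_UN) auto

lemma frontier_covered_eq: "frontier (covered i x) = covered i x - interior (covered i x)"
  using compact_imp_closed[OF compact_covered] by (simp add: frontier_def)

lemma interior_covered:
  assumes "c \<in> Td"
  shows "open_segment (start i c) (finish i c) \<subseteq> interior (covered i (coord i c))"
proof (rule interior_maximal)
  show "open_segment (start i c) (finish i c) \<subseteq> covered i (coord i c)"
    unfolding covered_def using assms segment_open_subset_closed by blast
qed (simp add: open_segment_eq_real_ivl)

lemma interior_covered_nonempty:
  assumes "x \<in> labels i Ts" "i \<in> {1, 2, 3}"
  shows "interior (covered i x) \<noteq> {}"
proof -
  obtain c where c: "c \<in> Td" "coord i c = x" using label_in_Td[OF assms] .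
  have "open_segment (start i c) (finish i c) \<noteq> {}"
    using start_neq_finish[OF c(1)] by simp
  then show ?thesis using interior_covered[OF c(1), of i] c(2) by blast
qed

text \<open>A frontier point is not inside an open side, so it is an end of a side and a crossing of
  two lines of some \<open>c\<close>. The partner \<open>p\<close> of \<open>c\<close> for these two
  labels gives the same crossing. If \<open>p\<close> is not \<open>a\<close>, its lines are
  concurrent and start and finish agree; otherwise the point is a corner of
  \<open>Sigma_triangle\<close>.\<close>

lemma frontier_covered:
  assumes i: "i \<in> {1, 2, 3}" and z: "z \<in> frontier (covered i x)"
  shows "(\<exists>p \<in> Ts - {a}. coord i p = x \<and> z = start i p) \<or>
    (x = coord i a \<and> z \<in> {start i a, finish i a})"
proof -
  obtain c where c: "c \<in> Td" "coord i c = x" "z \<in> closed_segment (start i c) (finish i c)"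
    using z unfolding frontier_covered_eq by (auto simp only: covered_def)
  have "z \<notin> open_segment (start i c) (finish i c)"
    using z interior_covered[OF c(1), of i] c(2) unfolding frontier_covered_eq by blast
  then consider "z = start i c" | "z = finish i c"
    using c(3) unfolding open_segment_def by blast
  then show ?thesis
  proof cases
    case 1
    obtain p where p: "p \<in> Ts" "coord i p = coord i c" "coord (nxt i) p = coord (nxt i) c"
      using obtain_Ts[OF c(1) i nxt_prv(1,3)[OF i]] .
    then have "z = start i p" using start_cong[OF i] 1 by metis
    moreover have "coord i p = x" using p(2) c(2) by simp
    ultimately show ?thesis using p(1) by (cases "p = a") (simp, blast)
  next
    case 2
    obtain p where p: "p \<in> Ts" "coord i p = coord i c" "coord (prv i) p = coord (prv i) c"
      using obtain_Ts[OF c(1) i nxt_prv(2,4)[OF i]] .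
    then have "z = finish i p" using finish_cong[OF i] 2 by metis
    moreover have "finish i p = start i p" if "p \<noteq> a"
      using gap_Ts[of p] p(1) that by (simp add: finish_eq_start)
    moreover have "coord i p = x" using p(2) c(2) by simp
    ultimately show ?thesis using p(1) by (cases "p = a") (simp, blast)
  qed
qed

text \<open>On line \<open>i\<close>, the side of \<open>c\<close> leaves the point of
  \<open>p\<close> and the side of \<open>d\<close> arrives there. Equal orientations place them on
  opposite sides of the point.\<close>

lemma interior_covered_through:
  assumes i: "i \<in> {1, 2, 3}" and p: "p \<in> Ts - {a}" and "c \<in> Td" "d \<in> Td"
    and c: "coord i c = coord i p" "coord (nxt i) c = coord (nxt i) p"
    and d: "coord i d = coord i p" "coord (prv i) d = coord (prv i) p"
    and "0 < gap c * gap d"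
  shows "start i p \<in> interior (covered i (coord i p))"
proof -
  define \<epsilon> :: real where "\<epsilon> = (if i = 2 then -1 else 1)"
  have "start i c = start i p" using start_cong[OF i c] .
  moreover from this have "finish i c = start i p + \<epsilon> * gap c"
    by (simp add: finish_eq_start \<epsilon>_def)
  moreover have "finish i d = start i p"
    using finish_cong[OF i d] gap_Ts[OF p] by (simp add: finish_eq_start)
  moreover from this have "start i d = start i p - \<epsilon> * gap d"
    using finish_eq_start[of i d] by (simp add: \<epsilon>_def)
  moreover have "closed_segment (start i c) (finish i c) \<subseteq> covered i (coord i p)"
    using assms(3) c(1) unfolding covered_def by blast
  moreover have "closed_segment (start i d) (finish i d) \<subseteq> covered i (coord i p)"
    using assms(4) d(1) unfolding covered_def by blast
  ultimately have "closed_segment (start i p) (start i p + \<epsilon> * gap c)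
      \<union> closed_segment (start i p - \<epsilon> * gap d) (start i p) \<subseteq> covered i (coord i p)"
    by simp
  moreover have "0 < (\<epsilon> * gap c) * (\<epsilon> * gap d)"
    using assms(9) by (simp add: \<epsilon>_def)
  ultimately show ?thesis
    using interior_adjacent_segments interior_mono by blast
qed

text \<open>Each of the three lines through a point \<open>p\<close> of the dissection either ends at \<open>p\<close> or passes
  through it, and it passes through as soon as the two triangles at \<open>p\<close> having a side on it have
  the same orientation. Two of the three triangles at \<open>p\<close> do.\<close>

lemma card_ends_le_2:
  assumes p: "p \<in> Ts - {a}"
  shows "card {i \<in> {1, 2, 3}. start i p \<in> frontier (covered i (coord i p))} \<le> 2"
proof -
  have "\<exists>c. c \<in> Td \<and> coord i c = coord i p \<and> coord (nxt i) c = coord (nxt i) p"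
    if "i \<in> {1, 2, 3}" for i
    using obtain_Td[OF _ that nxt_prv(1,3)[OF that], of p] p by blast
  \<comment> \<open>\<open>C i\<close> has the side on line \<open>i\<close> that leaves
    \<open>p\<close>. The side arriving at \<open>p\<close> on that line belongs to
    \<open>C (prv i)\<close>, since \<open>nxt (prv i) = i\<close>.\<close>
  then obtain C where C: "\<And>i. i \<in> {1, 2, 3} \<Longrightarrow>
      C i \<in> Td \<and> coord i (C i) = coord i p \<and> coord (nxt i) (C i) = coord (nxt i) p"
    by metis
  have "gap (C 1) \<noteq> 0" "gap (C 2) \<noteq> 0" "gap (C 3) \<noteq> 0"
    using C[OF index(1)] C[OF index(2)] C[OF index(3)] gap_Td by blast+
  then have "0 < gap (C 1) * gap (C 3) \<or> 0 < gap (C 2) * gap (C 1) \<or> 0 < gap (C 3) * gap (C 2)"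
    by (simp only: zero_less_mult_iff) linarith
  then obtain i where i: "i \<in> {1, 2, 3}" "0 < gap (C i) * gap (C (prv i))"
  proof (elim disjE)
    assume "0 < gap (C 1) * gap (C 3)"
    then show thesis by (intro that[OF index(1)]) (simp add: prv_def)
  next
    assume "0 < gap (C 2) * gap (C 1)"
    then show thesis by (intro that[OF index(2)]) (simp add: prv_def)
  next
    assume "0 < gap (C 3) * gap (C 2)"
    then show thesis by (intro that[OF index(3)]) (simp add: prv_def)
  qed
  have "start i p \<in> interior (covered i (coord i p))"
    using interior_covered_through[OF i(1) p, of "C i" "C (prv i)"] C[OF i(1)]
      C[OF nxt_prv(2)[OF i(1)]] nxt_prv(5)[OF i(1)] i(2) by simp
  then have "{i \<in> {1, 2, 3}. start i p \<in> frontier (covered i (coord i p))} \<subseteq> {1, 2, 3} - {i}"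
    unfolding frontier_covered_eq by blast
  then have "card {i \<in> {1, 2, 3}. start i p \<in> frontier (covered i (coord i p))} \<le> card ({1, 2, 3} - {i})"
    by (intro card_mono) auto
  also have "\<dots> = 2" using i(1) by (simp add: card_Diff_singleton)
  finally show ?thesis .
qed

section \<open>Counting the ends of the lines\<close>

text \<open>Ends are recorded as elements of \<open>Ts\<close>, not as parameters, so that they can
  be counted element by element across all lines.\<close>

definition ends :: "nat \<Rightarrow> 'a \<Rightarrow> 'a triple set" where
  "ends i x = {p \<in> Ts - {a}. coord i p = x \<and> start i p \<in> frontier (covered i x)}"

lemma finite_ends: "finite (ends i x)"
  using finite_Ts by (simp add: ends_def)

lemma finite_labels: "finite (labels i Ts)"
  using finite_Ts by (simp add: labels_def)

lemma card_ends_ge_2: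
  assumes i: "i \<in> {1, 2, 3}" and x: "x \<in> labels i Ts" "x \<noteq> coord i a"
  shows "2 \<le> card (ends i x)"
proof -
  obtain m M where mM: "m < M" "m \<in> frontier (covered i x)" "M \<in> frontier (covered i x)"
    using compact_real_frontier_bounds[OF compact_covered interior_covered_nonempty[OF x(1) i]] .
  obtain p where p: "p \<in> ends i x" "m = start i p"
    using frontier_covered[OF i mM(2)] x(2) mM(2) unfolding ends_def by blast
  obtain q where q: "q \<in> ends i x" "M = start i q"
    using frontier_covered[OF i mM(3)] x(2) mM(3) unfolding ends_def by blast
  have "p \<noteq> q" using p q mM(1) by auto
  moreover have "card {p, q} \<le> card (ends i x)"
    using p(1) q(1) by (intro card_mono finite_ends) auto
  ultimately show ?thesis by simp
qed

text \<open>Double counting: grouped by element instead of by line, each element contributes at most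
  two ends.\<close>

lemma sum_card_ends: "(\<Sum>i\<in>{1, 2, 3}. \<Sum>x\<in>labels i Ts. card (ends i x)) \<le> 2 * (card Ts - 1)"
proof -
  define P where "P i p \<longleftrightarrow> start i p \<in> frontier (covered i (coord i p))" for i p
  have "(\<Sum>x\<in>labels i Ts. card (ends i x)) = (\<Sum>p\<in>Ts - {a}. of_bool (P i p))" for i
  proof -
    have "card (ends i x) = (\<Sum>p\<in>{p \<in> Ts - {a}. coord i p = x}. of_bool (P i p))" for x
    proof -
      have "{p \<in> Ts - {a}. coord i p = x} \<inter> {p. P i p} = ends i x"
        unfolding ends_def P_def by blast
      then show ?thesis using finite_Ts by (simp add: of_bool_def sum.If_cases)
    qed
    moreover have "(\<Sum>x\<in>labels i Ts. \<Sum>p\<in>{p \<in> Ts - {a}. coord i p = x}. of_bool (P i p)) =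
        (\<Sum>p\<in>Ts - {a}. of_bool (P i p) :: nat)"
      using finite_Ts finite_labels by (intro sum.group) (auto simp: labels_def)
    ultimately show ?thesis by simp
  qed
  then have "(\<Sum>i\<in>{1, 2, 3}. \<Sum>x\<in>labels i Ts. card (ends i x)) =
      (\<Sum>i\<in>{1, 2, 3}. \<Sum>p\<in>Ts - {a}. of_bool (P i p))" by simp
  also have "\<dots> = (\<Sum>p\<in>Ts - {a}. \<Sum>i\<in>{1, 2, 3}. of_bool (P i p))" by (rule sum.swap)
  also have "\<dots> \<le> (\<Sum>p\<in>Ts - {a}. 2)"
  proof (rule sum_mono)
    fix p assume "p \<in> Ts - {a}"
    moreover have "(\<Sum>i\<in>{1, 2, 3}. of_bool (P i p)) = card {i \<in> {1, 2, 3::nat}. P i p}"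
      by (subst card_eq_sum, subst sum.inter_filter) (simp_all add: of_bool_def)
    ultimately show "(\<Sum>i\<in>{1, 2, 3}. of_bool (P i p)) \<le> (2 :: nat)"
      using card_ends_le_2 unfolding P_def by simp
  qed
  also have "\<dots> = 2 * (card Ts - 1)"
    using finite_Ts a_in by (simp add: card_Diff_singleton)
  finally show ?thesis .
qed

text \<open>The lower bounds \<open>b i x\<close> already add up to the upper bound of
  \<open>sum_card_ends\<close>, so each of them is attained.\<close>

lemma card_ends:
  assumes sph: "card (labels 1 Ts) + card (labels 2 Ts) + card (labels 3 Ts) = card Ts + 2"
    and i: "i \<in> {1, 2, 3}" and x: "x \<in> labels i Ts"
  shows "card (ends i x) = (if x = coord i a then 0 else 2)"
proof -
  define b :: "nat \<Rightarrow> 'a \<Rightarrow> nat" where "b i x = (if x = coord i a then 0 else 2)" for i x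
  have b_le: "b i x \<le> card (ends i x)" if "i \<in> {1, 2, 3}" "x \<in> labels i Ts" for i x
    using card_ends_ge_2[OF that] by (simp add: b_def)
  then have sum_b_le: "sum (b i) (labels i Ts) \<le> (\<Sum>x\<in>labels i Ts. card (ends i x))"
    if "i \<in> {1, 2, 3}" for i
    using that by (intro sum_mono)
  have a_label: "coord i a \<in> labels i Ts" for i
    using a_in by (simp add: labels_def)
  have sum_b: "sum (b i) (labels i Ts) = 2 * (card (labels i Ts) - 1)" for i
  proof -
    have "sum (b i) (labels i Ts) = b i (coord i a) + sum (b i) (labels i Ts - {coord i a})"
      using a_label finite_labels by (rule sum.remove[rotated])
    also have "\<dots> = (\<Sum>x\<in>labels i Ts - {coord i a}. 2)"
      by (simp add: b_def)
    finally show ?thesis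
      using a_label finite_labels by (simp add: card_Diff_singleton)
  qed
  \<comment> \<open>Positivity keeps the truncated subtractions of 1 exact.\<close>
  have pos: "0 < card (labels i Ts)" for i
    using a_label finite_labels card_gt_0_iff by blast
  have "(\<Sum>i\<in>{1, 2, 3}. sum (b i) (labels i Ts)) = 2 * (card Ts - 1)"
    unfolding sum_b using sph pos[of 1] pos[of 2] pos[of 3] by simp
  then have "(\<Sum>i\<in>{1, 2, 3}. sum (b i) (labels i Ts)) =
      (\<Sum>i\<in>{1, 2, 3}. \<Sum>x\<in>labels i Ts. card (ends i x))"
    using sum_card_ends
      sum_mono[of "{1, 2, 3}" "\<lambda>i. sum (b i) (labels i Ts)" "\<lambda>i. \<Sum>x\<in>labels i Ts. card (ends i x)",
        OF sum_b_le] by linarith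
  \<comment> \<open>Equal sums with termwise inequalities force equal terms, first over the three
    kinds of lines and then over the labels of one kind.\<close>
  then have "sum (b i) (labels i Ts) = (\<Sum>x\<in>labels i Ts. card (ends i x))"
    using sum_mono_inv[of "\<lambda>i. sum (b i) (labels i Ts)" "{1, 2, 3}"] sum_b_le i by blast
  then have "b i x = card (ends i x)"
    using sum_mono_inv[of "b i" "labels i Ts"] b_le i x finite_labels by blast
  then show ?thesis by (simp add: b_def)
qed

lemma covered_contiguous:
  assumes sph: "card (labels 1 Ts) + card (labels 2 Ts) + card (labels 3 Ts) = card Ts + 2"
    and i: "i \<in> {1, 2, 3}" and x: "x \<in> labels i Ts"
  shows "\<exists>u w. covered i x = closed_segment u w"
proof -
  have "\<exists>A. finite A \<and> frontier (covered i x) \<subseteq> A \<and> card A \<le> 2"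
  proof (cases "x = coord i a")
    \<comment> \<open>The lines of \<open>a\<close> have no further ends, so only the corners of
      \<open>Sigma_triangle\<close> remain as frontier points.\<close>
    case True
    then have "ends i x = {}" using card_ends[OF assms] finite_ends by simp
    then have "frontier (covered i x) \<subseteq> {start i a, finish i a}"
      using frontier_covered[OF i] unfolding ends_def by blast
    then show ?thesis by (intro exI[of _ "{start i a, finish i a}"]) (simp add: card_insert_if)
  next
    case False
    then have "frontier (covered i x) \<subseteq> start i ` ends i x"
      using frontier_covered[OF i] unfolding ends_def by blast
    moreover have "card (start i ` ends i x) \<le> 2"
      using card_image_le[OF finite_ends, of "start i" i x] card_ends[OF assms] False by simp
    ultimately show ?thesis
      by (intro exI[of _ "start i ` ends i x"] conjI finite_imageI finite_ends)
  qed
  then obtain A where A: "finite A" "frontier (covered i x) \<subseteq> A" "card A \<le> 2" by blast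
  show ?thesis
    using compact_real_two_frontier_points[OF compact_covered interior_covered_nonempty[OF x i]]
      finite_subset[OF A(2,1)] card_mono[OF A(1,2)] A(3) by simp
qed

section \<open>From line parameters back to the plane\<close>

definition side :: "nat \<Rightarrow> 'a triple \<Rightarrow> (real \<times> real) set" where
  "side i c = on_line i (val i c) ` closed_segment (start i c) (finish i c)"

lemma edge_of_Delta_iff:
  assumes "c \<in> Td"
  shows "e edge_of Delta v c \<longleftrightarrow> (\<exists>i\<in>{1, 2, 3}. e = side i c)"
  unfolding Delta_eq edge_of_triangle_iff[OF val_nondegenerate[OF assms]] side_def start_def finish_def
  by simp

lemma affine_hull_side:
  assumes "c \<in> Td"
  shows "affine hull (side i c) = range (on_line i (val i c))"
  unfolding side_def on_line_segment
  unfolding segment_convex_hull affine_hull_convex_hull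
  using range_on_line[OF start_neq_finish[OF assms]] by metis

text \<open>The affine hull of a side has dimension 1, so it fills any line containing the
  side.\<close>

lemma line_through_side:
  assumes c: "c \<in> Td" "i \<in> {1, 2, 3}" "side i c \<subseteq> p" and p: "affine p" "aff_dim p = 1"
  shows "p = range (on_line i (val i c))"
proof -
  have "side i c edge_of Delta v c" using edge_of_Delta_iff[OF c(1)] c(2) by blast
  then have "aff_dim (affine hull side i c) = 1"
    by (simp add: edge_of_def)
  then have "affine hull side i c = p"
    using p c(3) by (intro affine_dim_equal hull_minimal) auto
  then show ?thesis using affine_hull_side[OF c(1)] by simp
qed

lemma sides_contiguous:
  assumes sph: "card (labels 1 Ts) + card (labels 2 Ts) + card (labels 3 Ts) = card Ts + 2"
    and p: "affine p" "aff_dim p = 1" and e: "\<exists>t\<in>Delta v ` Td. \<exists>e. e edge_of t \<and> e \<subseteq> p"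
  shows "\<exists>u w. \<Union>{e. e \<subseteq> p \<and> (\<exists>t\<in>Delta v ` Td. e edge_of t)} = closed_segment u w"
proof -
  obtain c i where c: "c \<in> Td" "i \<in> {1, 2, 3}" "side i c \<subseteq> p"
    using e edge_of_Delta_iff by blast
  have p_eq: "p = range (on_line i (val i c))" using line_through_side[OF c p] .
  \<comment> \<open>A line determines its kind and its value, and by separatedness the value
    determines the label.\<close>
  have "{e. e \<subseteq> p \<and> (\<exists>t\<in>Delta v ` Td. e edge_of t)} = side i ` {d \<in> Td. coord i d = coord i c}"
  proof (intro subset_antisym subsetI)
    fix e assume "e \<in> {e. e \<subseteq> p \<and> (\<exists>t\<in>Delta v ` Td. e edge_of t)}"
    then obtain d j where d: "d \<in> Td" "j \<in> {1, 2, 3}" "e = side j d" "side j d \<subseteq> p"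
      using edge_of_Delta_iff by blast
    have "range (on_line j (val j d)) = range (on_line i (val i c))"
      using line_through_side[OF d(1,2,4) p] p_eq by simp
    then have "j = i" "val i d = val i c"
      using range_on_line_inject[OF _ d(2) c(2)] by blast+
    then show "e \<in> side i ` {d \<in> Td. coord i d = coord i c}"
      using d(1,3) c(1) val_eq_iff[OF _ _ c(2), of d c] by blast
  next
    fix e assume "e \<in> side i ` {d \<in> Td. coord i d = coord i c}"
    then obtain d where d: "d \<in> Td" "coord i d = coord i c" "e = side i d" by blast
    then have "e \<subseteq> p" unfolding p_eq side_def val_def by auto
    then show "e \<in> {e. e \<subseteq> p \<and> (\<exists>t\<in>Delta v ` Td. e edge_of t)}"
      using edge_of_Delta_iff[OF d(1)] d c(2) by blast
  qed
  moreover have "\<Union>(side i ` {d \<in> Td. coord i d = coord i c}) =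
      on_line i (val i c) ` covered i (coord i c)"
    unfolding covered_def image_UN side_def val_def by (intro SUP_cong) auto
  moreover obtain u w where "covered i (coord i c) = closed_segment u w"
    using covered_contiguous[OF sph c(2) coord_Td_in_labels[OF c(1,2)]] by blast
  ultimately show ?thesis using on_line_segment[of i "val i c" u w] by metis
qed

lemma separated_dissection_Delta:
  assumes "card (labels 1 Ts) + card (labels 2 Ts) + card (labels 3 Ts) = card Ts + 2"
  shows "separated_dissection (Delta v ` Td)"
  unfolding separated_dissection_def
proof (intro conjI allI impI notI)
  assume "\<exists>z F. F \<subseteq> Delta v ` Td \<and> card F = 6 \<and> (\<forall>t\<in>F. z extreme_point_of t)"
  then obtain z F where F: "F \<subseteq> Delta v ` Td" "card F = 6" "\<forall>t\<in>F. z extreme_point_of t"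
    by blast
  then have "card F \<le> 3" using few_triangles_at_point[of F z] by blast
  then show False using F(2) by simp
next
  fix p :: "(real \<times> real) set"
  assume "affine p \<and> aff_dim p = 1 \<and> (\<exists>t\<in>Delta v ` Td. \<exists>e. e edge_of t \<and> e \<subseteq> p)"
  then show "\<exists>u w. \<Union>{e. e \<subseteq> p \<and> (\<exists>t\<in>Delta v ` Td. e edge_of t)} = closed_segment u w"
    using sides_contiguous[OF assms] by blast
qed

lemma not_degenerate:
  assumes "c \<in> Td"
  shows "\<not> degenerate v c"
  using val_nondegenerate[OF assms]
  by (auto simp: degenerate_def row_line_def column_line_def symbol_line_def val_def)

end

theorem theorem2p1:
  fixes Ts Td :: "'a triple set" and a :: "'a triple" and v :: "'a \<Rightarrow> rat"
  assumes "spherical Ts Td"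
    and "a \<in> Ts"
    and "Eq_solution Ts a v"
    and "separated_solution Ts v"
  shows "(\<forall>c\<in>Td. \<not> degenerate v c) \<and>
         (\<Union>c\<in>Td. Delta v c) = Sigma_triangle \<and>
         (\<forall>c\<in>Td. \<forall>c'\<in>Td. c \<noteq> c' \<longrightarrow> interior (Delta v c) \<inter> interior (Delta v c') = {}) \<and>
         separated_dissection (Delta v ` Td)"
proof -
  interpret bitrade_solution Ts Td a v
    using assms by unfold_locales (simp_all only: spherical_def)
  have "card (labels 1 Ts) + card (labels 2 Ts) + card (labels 3 Ts) = card Ts + 2"
    using assms(1) by (simp only: spherical_def)
  then show ?thesis
    by (intro conjI ballI impI not_degenerate Union_Delta interior_Delta_disjoint
        separated_dissection_Delta)
qed

end
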